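(* Let $\mathfrak n_{5,1}$ be the Lie algebra over $\mathbb F$ with ordered basis $\{x_1,x_2,x_3,x_4,x_5\}$ whose only nonzero brackets of basis elements (up to skew-symmetry) are $[x_5,x_3]=-x_1$ and $[x_5,x_4]=-x_2$. Then for all $j,k,l,m,n,p,q,r,s,t\in\mathbb Z_{\ge0}$ the following identity holds in $\mathbf U(\mathfrak n_{5,1})$: $$\begin{aligned} &(x_1^jx_2^kx_3^lx_4^mx_5^n)(x_1^px_2^qx_3^rx_4^sx_5^t)\\ &=\sum_{\alpha=0}^{\min\{n,r\}}\ \sum_{\beta=0}^{\min\{n-\alpha,s\}}\binom{n}{\alpha}\binom{r}{\alpha}\binom{n-\alpha}{\beta}\binom{s}{\beta}\alpha!\,\beta!\,(-1)^{\alpha+\beta}\, x_1^{j+p+\alpha}x_2^{k+q+\beta}x_3^{l+r-\alpha}x_4^{m+s-\beta}x_5^{n+t-\alpha-\beta}. \end{aligned}$$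
   Context: $\mathbb F$ is $\mathbb R$ or $\mathbb C$. $\mathbf U(L)$ denotes the universal enveloping algebra of the Lie algebra $L$ (the universal unital associative $\mathbb F$-algebra with a linear map $\iota:L\to\mathbf U(L)$ satisfying $\iota([x,y])=\iota(x)\iota(y)-\iota(y)\iota(x)$). Elements of $L$ are identified with their images under $\iota$, so $xy=yx+[x,y]$ in $\mathbf U(L)$ for $x,y\in L$; powers and products of the $x_i$ are taken in $\mathbf U(L)$. *)

theory Defs
  imports "HOL-Algebra.QuotRing" "HOL-Algebra.Module" "HOL-Library.Poly_Mapping" Complex_Main
begin

section \<open>Base fields\<close>

text \<open>Fields isomorphic to the field of real numbers or to the field of complex numbers.\<close>

class real_or_complex = field +
  assumes real_or_complex:
    "(\<exists>f :: 'a \<Rightarrow> real. bij f \<and> f 1 = 1 \<and>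
        (\<forall>a b. f (a + b) = f a + f b) \<and> (\<forall>a b. f (a * b) = f a * f b)) \<or>
     (\<exists>f :: 'a \<Rightarrow> complex. bij f \<and> f 1 = 1 \<and>
        (\<forall>a b. f (a + b) = f a + f b) \<and> (\<forall>a b. f (a * b) = f a * f b))"

instance real :: real_or_complex
  by standard (rule disjI1, rule exI[of _ id], simp)

instance complex :: real_or_complex
  by standard (rule disjI2, rule exI[of _ id], simp)

section \<open>Lie algebras\<close>

locale lie_algebra = vector_space scale
  for scale :: "'k::field \<Rightarrow> 'a::ab_group_add \<Rightarrow> 'a" +
  fixes bracket :: "'a \<Rightarrow> 'a \<Rightarrow> 'a"
  assumes bracket_add_left: "bracket (x + y) z = bracket x z + bracket y z"
    and bracket_add_right: "bracket x (y + z) = bracket x y + bracket x z"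
    and bracket_scale_left: "bracket (scale c x) y = scale c (bracket x y)"
    and bracket_scale_right: "bracket x (scale c y) = scale c (bracket x y)"
    and bracket_self: "bracket x x = 0"
    and jacobi: "bracket x (bracket y z) + bracket y (bracket z x) + bracket z (bracket x y) = 0"

locale n5_1 = lie_algebra scale bracket
  for scale :: "'k::field \<Rightarrow> 'a::ab_group_add \<Rightarrow> 'a" and bracket :: "'a \<Rightarrow> 'a \<Rightarrow> 'a" +
  fixes x1 x2 x3 x4 x5 :: 'a
  assumes basis_distinct: "distinct [x1, x2, x3, x4, x5]"
    and basis_independent: "independent {x1, x2, x3, x4, x5}"
    and basis_span: "span {x1, x2, x3, x4, x5} = UNIV"
    and bracket_53: "bracket x5 x3 = - x1"
    and bracket_54: "bracket x5 x4 = - x2"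
    and bracket_21: "bracket x2 x1 = 0"
    and bracket_31: "bracket x3 x1 = 0"
    and bracket_41: "bracket x4 x1 = 0"
    and bracket_51: "bracket x5 x1 = 0"
    and bracket_32: "bracket x3 x2 = 0"
    and bracket_42: "bracket x4 x2 = 0"
    and bracket_52: "bracket x5 x2 = 0"
    and bracket_43: "bracket x4 x3 = 0"

section \<open>Unital associative algebras\<close>

text \<open>The library's locale \<^locale>\<open>algebra\<close> is about commutative algebras.\<close>

locale assoc_algebra = ring A
  for A :: "('k::field, 'b, 'm) module_scheme" (structure) +
  assumes smult_closed: "x \<in> carrier A \<Longrightarrow> c \<odot> x \<in> carrier A"
    and smult_l_distr: "x \<in> carrier A \<Longrightarrow> (c + d) \<odot> x = c \<odot> x \<oplus> d \<odot> x"
    and smult_r_distr: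
      "\<lbrakk>x \<in> carrier A; y \<in> carrier A\<rbrakk> \<Longrightarrow> c \<odot> (x \<oplus> y) = c \<odot> x \<oplus> c \<odot> y"
    and smult_assoc: "x \<in> carrier A \<Longrightarrow> (c * d) \<odot> x = c \<odot> (d \<odot> x)"
    and smult_one: "x \<in> carrier A \<Longrightarrow> 1 \<odot> x = x"
    and smult_mult_left:
      "\<lbrakk>x \<in> carrier A; y \<in> carrier A\<rbrakk> \<Longrightarrow> (c \<odot> x) \<otimes> y = c \<odot> (x \<otimes> y)"
    and smult_mult_right:
      "\<lbrakk>x \<in> carrier A; y \<in> carrier A\<rbrakk> \<Longrightarrow> x \<otimes> (c \<odot> y) = c \<odot> (x \<otimes> y)"

section \<open>The free algebra on a set of letters\<close>

text \<open>
  Words under concatenation, wrapped so that the additive notation which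
  \<^type>\<open>poly_mapping\<close> expects for the exponent monoid is not imposed on lists.
  The type \<open>'a word_monoid \<Rightarrow>\<^sub>0 'k\<close> with its convolution product is then the free unital
  associative algebra on \<open>'a\<close>.
\<close>

datatype 'a word_monoid = Word (letters: "'a list")

instantiation word_monoid :: (type) monoid_add
begin

definition zero_word_monoid :: "'a word_monoid"
  where "0 = Word []"

definition plus_word_monoid :: "'a word_monoid \<Rightarrow> 'a word_monoid \<Rightarrow> 'a word_monoid"
  where "v + w = Word (letters v @ letters w)"

instance
  by standard (simp_all add: zero_word_monoid_def plus_word_monoid_def)

end

type_synonym ('a, 'k) free_algebra = "'a word_monoid \<Rightarrow>\<^sub>0 'k"

definition free_algebra_ring :: "('a, 'k::field) free_algebra ring"
  where "free_algebra_ring = \<lparr>carrier = UNIV, mult = (*), one = 1, zero = 0, add = (+)\<rparr>"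

definition scalar :: "'k::field \<Rightarrow> ('a, 'k) free_algebra"
  where "scalar c = Poly_Mapping.single 0 c"

definition letter :: "'a \<Rightarrow> ('a, 'k::field) free_algebra"
  where "letter x = Poly_Mapping.single (Word [x]) 1"

section \<open>The universal enveloping algebra\<close>

text \<open>
  The first two families of relations make \<^const>\<open>letter\<close> linear, so that they alone would give
  the tensor algebra of the underlying vector space.
\<close>

definition uea_relations ::
    "('k::field \<Rightarrow> 'a::ab_group_add \<Rightarrow> 'a) \<Rightarrow> ('a \<Rightarrow> 'a \<Rightarrow> 'a) \<Rightarrow> ('a, 'k) free_algebra set"
  where "uea_relations scale bracket =
    {letter (x + y) - (letter x + letter y) | x y. True} \<union>
    {letter (scale c x) - scalar c * letter x | c x. True} \<union>
    {letter (bracket x y) - (letter x * letter y - letter y * letter x) | x y. True}"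

definition uea_ideal ::
    "('k::field \<Rightarrow> 'a::ab_group_add \<Rightarrow> 'a) \<Rightarrow> ('a \<Rightarrow> 'a \<Rightarrow> 'a) \<Rightarrow> ('a, 'k) free_algebra set"
  where "uea_ideal scale bracket = Idl\<^bsub>free_algebra_ring\<^esub> (uea_relations scale bracket)"

definition uea_class ::
    "('k::field \<Rightarrow> 'a::ab_group_add \<Rightarrow> 'a) \<Rightarrow> ('a \<Rightarrow> 'a \<Rightarrow> 'a) \<Rightarrow>
      ('a, 'k) free_algebra \<Rightarrow> ('a, 'k) free_algebra set"
  where "uea_class scale bracket p = uea_ideal scale bracket +>\<^bsub>free_algebra_ring\<^esub> p"

text \<open>
  The ring structure is that of the quotient ring
  \<^term>\<open>free_algebra_ring Quot uea_ideal scale bracket\<close>; multiplication by a scalar is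
  multiplication by the class of that scalar.
\<close>

definition uea ::
    "('k::field \<Rightarrow> 'a::ab_group_add \<Rightarrow> 'a) \<Rightarrow> ('a \<Rightarrow> 'a \<Rightarrow> 'a) \<Rightarrow>
      ('k, ('a, 'k) free_algebra set) module"
  where "uea scale bracket = (let Q = free_algebra_ring Quot uea_ideal scale bracket in
    \<lparr>carrier = carrier Q, mult = mult Q, one = one Q, zero = zero Q, add = add Q,
     smult = (\<lambda>c X. uea_class scale bracket (scalar c) \<otimes>\<^bsub>Q\<^esub> X)\<rparr>)"

definition uea_embed ::
    "('k::field \<Rightarrow> 'a::ab_group_add \<Rightarrow> 'a) \<Rightarrow> ('a \<Rightarrow> 'a \<Rightarrow> 'a) \<Rightarrow> 'a \<Rightarrow> ('a, 'k) free_algebra set"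
  where "uea_embed scale bracket x = uea_class scale bracket (letter x)"

lemma ring_free_algebra_ring: "ring (free_algebra_ring :: ('a, 'k::field) free_algebra ring)"
proof -
  have "\<exists>q. q + p = 0" for p :: "('a, 'k) free_algebra"
    by (rule exI[of _ "- p"]) simp
  then show ?thesis
    by (intro ringI abelian_groupI monoidI)
       (auto simp: free_algebra_ring_def algebra_simps)
qed

lemma carrier_free_algebra_ring [simp]: "carrier free_algebra_ring = UNIV"
  by (simp add: free_algebra_ring_def)

lemma ideal_uea_ideal: "ideal (uea_ideal scale bracket) free_algebra_ring"
  unfolding uea_ideal_def by (rule ring.genideal_ideal[OF ring_free_algebra_ring]) simp

context
  fixes scale :: "'k::field \<Rightarrow> 'a::ab_group_add \<Rightarrow> 'a" and bracket :: "'a \<Rightarrow> 'a \<Rightarrow> 'a"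
begin

interpretation ideal "uea_ideal scale bracket" free_algebra_ring
  by (rule ideal_uea_ideal)

lemma carrier_uea: "carrier (uea scale bracket) = range (uea_class scale bracket)"
  by (auto simp: uea_def uea_class_def FactRing_def A_RCOSETS_def' Let_def)

lemma uea_class_mult:
  "uea_class scale bracket p \<otimes>\<^bsub>uea scale bracket\<^esub> uea_class scale bracket q =
    uea_class scale bracket (p * q)"
  using rcoset_mult_add[of p q]
  by (simp add: uea_def uea_class_def FactRing_def Let_def free_algebra_ring_def)

lemma uea_class_add:
  "uea_class scale bracket p \<oplus>\<^bsub>uea scale bracket\<^esub> uea_class scale bracket q =
    uea_class scale bracket (p + q)"
  using a_rcos_sum[of p q]
  by (simp add: uea_def uea_class_def FactRing_def Let_def free_algebra_ring_def)

lemma uea_class_one: "\<one>\<^bsub>uea scale bracket\<^esub> = uea_class scale bracket 1"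
  by (simp add: uea_def uea_class_def FactRing_def Let_def free_algebra_ring_def)

lemma uea_class_smult:
  "c \<odot>\<^bsub>uea scale bracket\<^esub> uea_class scale bracket p = uea_class scale bracket (scalar c * p)"
  using uea_class_mult[of "scalar c" p] by (simp add: uea_def Let_def)

lemma uea_class_eq_iff:
  "uea_class scale bracket p = uea_class scale bracket q \<longleftrightarrow> p - q \<in> uea_ideal scale bracket"
proof -
  have minus: "p \<ominus>\<^bsub>free_algebra_ring\<^esub> q = p - q"
  proof -
    have "\<ominus>\<^bsub>free_algebra_ring\<^esub> q = - q"
      by (rule minus_equality) (simp_all add: free_algebra_ring_def)
    then show ?thesis
      by (simp add: a_minus_def free_algebra_ring_def)
  qed
  show ?thesis
    using quotient_eq_iff_same_a_r_cos[OF ideal_uea_ideal, of p q]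
    by (simp add: uea_class_def minus)
qed

lemma uea_class_zero: "\<zero>\<^bsub>uea scale bracket\<^esub> = uea_class scale bracket 0"
  using a_coset_add_zero[of "uea_ideal scale bracket"]
  by (simp add: uea_def uea_class_def FactRing_def Let_def free_algebra_ring_def)

lemma ring_uea: "ring (uea scale bracket)"
proof -
  note simps = carrier_uea uea_class_mult uea_class_add uea_class_one uea_class_zero
  have "\<exists>q. uea_class scale bracket (q + p) = uea_class scale bracket 0" for p
    by (rule exI[of _ "- p"]) simp
  then show ?thesis
    by (intro ringI abelian_groupI monoidI) (auto simp: simps algebra_simps)
qed

lemma assoc_algebra_uea: "assoc_algebra (uea scale bracket)"
proof -
  have single_mult_commute: "q * scalar c = scalar c * q" for q :: "('a, 'k) free_algebra" and c
  proof (induction q rule: update_induct)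
    case const
    show ?case by simp
  next
    case (update p w b)
    have "Poly_Mapping.update w b p = p + Poly_Mapping.single w b"
      using update(1)
      by (intro poly_mapping_eqI)
         (auto simp: lookup_update lookup_add lookup_single in_keys_iff when_def)
    with update(3) show ?case
      by (simp add: scalar_def algebra_simps mult_single)
  qed
  have left_commute: "p * (scalar c * q) = scalar c * (p * q)" for p q :: "('a, 'k) free_algebra" and c
    by (simp only: mult.assoc[symmetric] single_mult_commute[of p c])
  have scalar: "scalar (c + d) = scalar c + scalar d" "scalar (c * d) = scalar c * scalar d"
    "scalar 1 = 1" for c d :: 'k
    by (simp_all add: scalar_def single_add mult_single)
  note simps = uea_class_mult uea_class_add uea_class_smult scalar
    distrib_left distrib_right mult.assoc
  show ?thesis
    by (intro assoc_algebra.intro assoc_algebra_axioms.intro ring_uea; unfold carrier_uea;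
        elim rangeE; hypsubst; (simp add: simps; fail | simp add: simps left_commute))
qed

lemma uea_embed_closed: "uea_embed scale bracket x \<in> carrier (uea scale bracket)"
  by (simp add: carrier_uea uea_embed_def)

lemma relation_in_uea_ideal: "u \<in> uea_relations scale bracket \<Longrightarrow> u \<in> uea_ideal scale bracket"
  unfolding uea_ideal_def using ring.genideal_self[OF ring_free_algebra_ring] by auto

lemma uea_embed_add:
  "uea_embed scale bracket (x + y) =
    uea_embed scale bracket x \<oplus>\<^bsub>uea scale bracket\<^esub> uea_embed scale bracket y"
  unfolding uea_embed_def uea_class_add uea_class_eq_iff
  by (rule relation_in_uea_ideal) (auto simp: uea_relations_def)

lemma uea_embed_scale:
  "uea_embed scale bracket (scale c x) = c \<odot>\<^bsub>uea scale bracket\<^esub> uea_embed scale bracket x"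
  unfolding uea_embed_def uea_class_smult uea_class_eq_iff
  by (rule relation_in_uea_ideal) (auto simp: uea_relations_def)

lemma uea_embed_bracket:
  "uea_embed scale bracket (bracket x y) =
    uea_embed scale bracket x \<otimes>\<^bsub>uea scale bracket\<^esub> uea_embed scale bracket y
      \<ominus>\<^bsub>uea scale bracket\<^esub>
    uea_embed scale bracket y \<otimes>\<^bsub>uea scale bracket\<^esub> uea_embed scale bracket x"
proof -
  interpret U: ring "uea scale bracket"
    by (rule ring_uea)
  have "letter (bracket x y) - (letter x * letter y - letter y * letter x) \<in> uea_ideal scale bracket"
    by (rule relation_in_uea_ideal) (auto simp: uea_relations_def)
  then have "uea_embed scale bracket (bracket x y) \<oplus>\<^bsub>uea scale bracket\<^esub>
      uea_embed scale bracket y \<otimes>\<^bsub>uea scale bracket\<^esub> uea_embed scale bracket x =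
    uea_embed scale bracket x \<otimes>\<^bsub>uea scale bracket\<^esub> uea_embed scale bracket y"
    unfolding uea_embed_def uea_class_mult uea_class_add uea_class_eq_iff
    by (simp add: algebra_simps)
  then show ?thesis
    by (metis U.add.inv_solve_right U.m_closed a_minus_def uea_embed_closed)
qed

end

subsection \<open>The universal property\<close>

locale assoc_algebra_hom = A: assoc_algebra A + B: assoc_algebra B
  for A :: "('k::field, 'b, 'm) module_scheme" and B :: "('k, 'c, 'n) module_scheme" +
  fixes h :: "'b \<Rightarrow> 'c"
  assumes hom: "h \<in> ring_hom A B"
    and hom_smult: "x \<in> carrier A \<Longrightarrow> h (c \<odot>\<^bsub>A\<^esub> x) = c \<odot>\<^bsub>B\<^esub> h x"

context assoc_algebra
begin

definition word_value :: "('x \<Rightarrow> 'b) \<Rightarrow> 'x word_monoid \<Rightarrow> 'b"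
  where "word_value f w = foldr (\<lambda>x y. f x \<otimes> y) (letters w) \<one>"

definition evaluation :: "('x \<Rightarrow> 'b) \<Rightarrow> ('x, 'k) free_algebra \<Rightarrow> 'b"
  where "evaluation f p = (\<Oplus>w\<in>Poly_Mapping.keys p. Poly_Mapping.lookup p w \<odot> word_value f w)"

lemma smult_zero: "x \<in> carrier A \<Longrightarrow> 0 \<odot> x = \<zero>"
  using smult_l_distr[of x 0 0] smult_closed[of x 0] by (simp add: add.l_cancel_one)

context
  fixes f :: "'x \<Rightarrow> 'b"
  assumes f: "f x \<in> carrier A"
begin

lemma word_value_closed: "word_value f w \<in> carrier A"
proof -
  have "foldr (\<lambda>x y. f x \<otimes> y) xs \<one> \<in> carrier A" for xs
    by (induction xs) (auto simp: f)
  then show ?thesis by (simp add: word_value_def)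
qed

lemma word_value_plus: "word_value f (v + w) = word_value f v \<otimes> word_value f w"
proof -
  have "foldr (\<lambda>x y. f x \<otimes> y) xs \<one> \<in> carrier A" for xs
    by (induction xs) (auto simp: f)
  then have "foldr (\<lambda>x y. f x \<otimes> y) (xs @ ys) \<one> =
      foldr (\<lambda>x y. f x \<otimes> y) xs \<one> \<otimes> foldr (\<lambda>x y. f x \<otimes> y) ys \<one>" for xs ys
    by (induction xs) (auto simp: f m_assoc)
  then show ?thesis by (simp add: word_value_def plus_word_monoid_def)
qed

lemma evaluation_superset:
  assumes "finite S" "Poly_Mapping.keys p \<subseteq> S"
  shows "evaluation f p = (\<Oplus>w\<in>S. Poly_Mapping.lookup p w \<odot> word_value f w)"
  unfolding evaluation_def
  using assms
  by (intro add.finprod_mono_neutral_cong_left)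
     (auto simp: smult_closed word_value_closed smult_zero in_keys_iff)

lemma evaluation_closed: "evaluation f p \<in> carrier A"
  unfolding evaluation_def by (rule finsum_closed) (auto simp: smult_closed word_value_closed)

lemma evaluation_add: "evaluation f (p + q) = evaluation f p \<oplus> evaluation f q"
proof -
  define S where "S = Poly_Mapping.keys p \<union> Poly_Mapping.keys q"
  have S: "finite S" "Poly_Mapping.keys p \<subseteq> S" "Poly_Mapping.keys q \<subseteq> S" "Poly_Mapping.keys (p + q) \<subseteq> S"
    using keys_add[of p q] by (auto simp: S_def)
  show ?thesis
    unfolding evaluation_superset[OF S(1,2)] evaluation_superset[OF S(1,3)]
      evaluation_superset[OF S(1,4)]
    by (subst finsum_addf[symmetric])
       (auto simp: lookup_add smult_l_distr smult_closed word_value_closed)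
qed

lemma evaluation_single: "evaluation f (Poly_Mapping.single w c) = c \<odot> word_value f w"
  using evaluation_superset[of "{w}" "Poly_Mapping.single w c"]
  by (simp add: smult_closed word_value_closed)

lemma evaluation_mult: "evaluation f (p * q) = evaluation f p \<otimes> evaluation f q"
proof (induction p rule: update_induct)
  case const
  show ?case
    by (simp add: evaluation_def[of _ 0] evaluation_closed)
next
  case (update p v b)
  have split: "Poly_Mapping.update v b p = p + Poly_Mapping.single v b"
    if "v \<notin> Poly_Mapping.keys p" for p :: "('x, 'k) free_algebra" and v b
    using that
    by (intro poly_mapping_eqI)
       (auto simp: lookup_update lookup_add lookup_single in_keys_iff when_def)
  have "evaluation f (Poly_Mapping.single v b * q) =
      evaluation f (Poly_Mapping.single v b) \<otimes> evaluation f q"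
  proof (induction q rule: update_induct)
    case const
    show ?case
      by (simp add: evaluation_def[of _ 0] evaluation_closed)
  next
    case (update q w c)
    then show ?case
      by (simp add: split algebra_simps evaluation_add evaluation_closed r_distr)
         (simp add: mult_single evaluation_single word_value_plus word_value_closed smult_closed
           smult_mult_left smult_mult_right flip: smult_assoc,
          simp add: mult.commute)
  qed
  with update show ?case
    by (simp add: split algebra_simps evaluation_add evaluation_closed l_distr)
qed

lemma evaluation_one: "evaluation f 1 = \<one>"
  unfolding single_one[symmetric] evaluation_single
  by (simp add: word_value_def zero_word_monoid_def smult_one)

lemma evaluation_scalar_mult: "evaluation f (scalar c * p) = c \<odot> evaluation f p"
  by (simp add: evaluation_mult scalar_def evaluation_single word_value_def zero_word_monoid_def
      smult_mult_left evaluation_closed)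

lemma evaluation_letter: "evaluation f (letter x) = f x"
  by (simp add: letter_def evaluation_single word_value_def smult_one f)

lemma evaluation_diff: "evaluation f (p - q) = evaluation f p \<ominus> evaluation f q"
proof -
  have "evaluation f (p - q) \<oplus> evaluation f q = evaluation f p"
    by (simp flip: evaluation_add)
  then show ?thesis
    using evaluation_closed by (metis a_minus_def add.inv_solve_right)
qed

end

text \<open>
  For every linear map \<open>f\<close> from a Lie algebra to \<open>A\<close> that turns the bracket into the
  commutator there is exactly one homomorphism from the enveloping algebra extending it.
\<close>

theorem uea_universal:
  fixes scale :: "'k \<Rightarrow> 'x::ab_group_add \<Rightarrow> 'x" and bracket :: "'x \<Rightarrow> 'x \<Rightarrow> 'x"
  assumes f: "\<And>x. f x \<in> carrier A"
    and f_add: "\<And>x y. f (x + y) = f x \<oplus> f y"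
    and f_scale: "\<And>c x. f (scale c x) = c \<odot> f x"
    and f_bracket: "\<And>x y. f (bracket x y) = f x \<otimes> f y \<ominus> f y \<otimes> f x"
  shows "\<exists>h. assoc_algebra_hom (uea scale bracket) A h \<and>
    (\<forall>x. h (uea_embed scale bracket x) = f x)" (is "\<exists>h. ?P h")
    and "\<lbrakk>assoc_algebra_hom (uea scale bracket) A h; \<forall>x. h (uea_embed scale bracket x) = f x;
          assoc_algebra_hom (uea scale bracket) A g; \<forall>x. g (uea_embed scale bracket x) = f x;
          X \<in> carrier (uea scale bracket)\<rbrakk> \<Longrightarrow> h X = g X"
proof -
  let ?U = "uea scale bracket" and ?cl = "uea_class scale bracket"
  interpret U: assoc_algebra ?U
    by (rule assoc_algebra_uea)
  have ev_hom: "evaluation f \<in> ring_hom free_algebra_ring A"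
    by (rule ring_hom_memI)
       (simp_all add: free_algebra_ring_def evaluation_closed[OF f] evaluation_mult[OF f]
         evaluation_add[OF f] evaluation_one[OF f])
  interpret ev: ring_hom_ring free_algebra_ring A "evaluation f"
    by (rule ring_hom_ringI2[OF ring_free_algebra_ring ring_axioms ev_hom])
  have "uea_relations scale bracket \<subseteq> a_kernel free_algebra_ring A (evaluation f)"
    unfolding uea_relations_def a_kernel_def'
    by (auto simp: evaluation_diff[OF f] evaluation_add[OF f] evaluation_scalar_mult[OF f]
        evaluation_mult[OF f, where p = "letter _"] evaluation_letter[OF f] f f_add f_scale f_bracket
        smult_closed r_neg minus_eq)
  then have kernel: "uea_ideal scale bracket \<subseteq> a_kernel free_algebra_ring A (evaluation f)"
    unfolding uea_ideal_def
    by (rule ring.genideal_minimal[OF ring_free_algebra_ring ev.kernel_is_ideal])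
  define h where "h X = evaluation f (SOME p. ?cl p = X)" for X
  have h: "h (?cl p) = evaluation f p" for p
  proof -
    let ?q = "SOME q. ?cl q = ?cl p"
    have "?cl ?q = ?cl p"
      by (rule someI[of _ p]) simp
    then have "?q - p \<in> uea_ideal scale bracket"
      by (simp add: uea_class_eq_iff)
    from subsetD[OF kernel this] have "evaluation f (?q - p) = \<zero>"
      unfolding a_kernel_def' by (simp only: mem_Collect_eq)
    moreover have "evaluation f ?q = evaluation f (?q - p) \<oplus> evaluation f p"
      unfolding evaluation_add[OF f, symmetric] by (simp only: diff_add_cancel)
    ultimately have "evaluation f ?q = evaluation f p"
      by (simp only: l_zero[OF evaluation_closed[OF f]])
    then show ?thesis
      by (simp only: h_def)
  qed
  have "assoc_algebra_hom ?U A h"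
  proof
    show "h \<in> ring_hom ?U A"
      by (rule ring_hom_memI)
         (auto simp: carrier_uea uea_class_mult uea_class_add uea_class_one h
           evaluation_closed[OF f] evaluation_mult[OF f] evaluation_add[OF f] evaluation_one[OF f])
  qed (auto simp: carrier_uea uea_class_smult h evaluation_scalar_mult[OF f])
  moreover have "\<forall>x. h (uea_embed scale bracket x) = f x"
    by (simp add: uea_embed_def h evaluation_letter[OF f])
  ultimately show "\<exists>h. ?P h" by blast
next
  let ?U = "uea scale bracket" and ?cl = "uea_class scale bracket"
  assume "assoc_algebra_hom ?U A h" "assoc_algebra_hom ?U A g"
    and on_letters: "\<forall>x. h (uea_embed scale bracket x) = f x"
      "\<forall>x. g (uea_embed scale bracket x) = f x"
    and "X \<in> carrier ?U"
  then interpret h: assoc_algebra_hom ?U A h + g: assoc_algebra_hom ?U A g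
    by simp_all
  have closed: "?cl p \<in> carrier ?U" for p
    by (simp add: carrier_uea)
  have word: "h (?cl (Poly_Mapping.single (Word xs) 1)) = g (?cl (Poly_Mapping.single (Word xs) 1))"
    for xs
  proof (induction xs)
    case Nil
    have "?cl (Poly_Mapping.single (Word []) 1) = \<one>\<^bsub>?U\<^esub>"
      unfolding uea_class_one by (simp flip: zero_word_monoid_def)
    then show ?case
      using ring_hom_one[OF h.hom] ring_hom_one[OF g.hom] by simp
  next
    case (Cons x xs)
    have "?cl (Poly_Mapping.single (Word (x # xs)) 1) =
        uea_embed scale bracket x \<otimes>\<^bsub>?U\<^esub> ?cl (Poly_Mapping.single (Word xs) 1)"
      by (simp add: uea_embed_def uea_class_mult letter_def mult_single plus_word_monoid_def)
    with Cons on_letters show ?case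
      using ring_hom_mult[OF h.hom uea_embed_closed closed]
        ring_hom_mult[OF g.hom uea_embed_closed closed] by simp
  qed
  have "h (?cl p) = g (?cl p)" for p
  proof (induction p rule: update_induct)
    case const
    have "?cl 0 = 0 \<odot>\<^bsub>?U\<^esub> ?cl 0"
      by (simp add: uea_class_smult)
    then show ?case
      by (metis closed h.hom_smult g.hom_smult smult_zero ring_hom_closed[OF h.hom]
          ring_hom_closed[OF g.hom])
  next
    case (update p w b)
    have "Poly_Mapping.update w b p = p + scalar b * Poly_Mapping.single w 1"
      using update(1)
      by (intro poly_mapping_eqI)
         (auto simp: scalar_def mult_single lookup_update lookup_add lookup_single in_keys_iff
           when_def)
    then have "?cl (Poly_Mapping.update w b p) =
        ?cl p \<oplus>\<^bsub>?U\<^esub> b \<odot>\<^bsub>?U\<^esub> ?cl (Poly_Mapping.single w 1)"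
      by (simp add: uea_class_add uea_class_smult)
    with update(3) word[of "letters w"] show ?case
      by (simp add: closed h.A.smult_closed h.hom_smult g.hom_smult
          ring_hom_add[OF h.hom] ring_hom_add[OF g.hom])
  qed
  with \<open>X \<in> carrier ?U\<close> show "h X = g X"
    by (auto simp: carrier_uea)
qed

end

end

theory Submission
  imports Defs
begin

text \<open>
  The letter \<open>x5\<close> fails to commute only with \<open>x3\<close> and \<open>x4\<close>, and in both cases the commutator is,
  up to sign, a central element: \<open>x1\<close> or \<open>x2\<close>. So each of the two pairs behaves like the
  generators of a Heisenberg (Weyl) algebra, where the normal form of \<open>y\<^sup>n x\<^sup>r\<close> is classical:
  moving one \<open>y\<close> to the right across \<open>x\<^sup>r\<close> acts on \<open>x\<^sup>r\<close> as \<open>c z \<cdot> d/dx\<close> plus passing through,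
  and iterating this as in the Leibniz rule makes \<open>\<alpha>\<close> out of the \<open>n\<close> copies of \<open>y\<close> differentiate.
  This gives the coefficient \<open>(n choose \<alpha>) (r choose \<alpha>) \<alpha>!\<close> of \<open>straighten_powers\<close>.

  In the product of two ordered monomials the only obstruction to ordering is the block
  \<open>x5\<^sup>n x3\<^sup>r x4\<^sup>s\<close>. Straightening \<open>x5\<^sup>n x3\<^sup>r\<close> leaves \<open>x5\<^bsup>n-\<alpha>\<^esup>\<close> in front of \<open>x4\<^sup>s\<close>, and straightening
  that second product gives the inner sum; all other factors commute and their powers are merged.
  Only the commutation relations of the five elements enter, so the formula holds for any five
  elements of an associative algebra that satisfy them (\<open>ordered_monomial_mult\<close>). The theorem is
  the case of the images of the basis in the enveloping algebra.
\<close>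

section \<open>Commuting powers\<close>

lemma (in monoid) commute_pow:
  assumes "x \<in> carrier G" "y \<in> carrier G" "x \<otimes> y = y \<otimes> x"
  shows "x \<otimes> y [^] (n::nat) = y [^] n \<otimes> x"
proof (induction n)
  case (Suc n)
  have "x \<otimes> (y [^] n \<otimes> y) = (x \<otimes> y [^] n) \<otimes> y"
    using assms by (simp add: m_assoc)
  also have "\<dots> = y [^] n \<otimes> (x \<otimes> y)"
    using assms(1,2) Suc by (simp add: m_assoc)
  also have "\<dots> = y [^] n \<otimes> y \<otimes> x"
    using assms by (simp add: m_assoc)
  finally show ?case by simp
qed (use assms in simp)

lemma (in monoid) pow_commute_pow:
  assumes "x \<in> carrier G" "y \<in> carrier G" "x \<otimes> y = y \<otimes> x"
  shows "x [^] (m::nat) \<otimes> y [^] (n::nat) = y [^] n \<otimes> x [^] m"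
  by (rule commute_pow[symmetric, OF _ _ commute_pow[symmetric]]) (use assms in auto)

text \<open>
  The next two lemmas are the rewriting rules, in right-associated form, by which products of
  powers of commuting elements are sorted and merged.
\<close>

lemma (in monoid) pow_left_commute:
  assumes "x \<in> carrier G" "y \<in> carrier G" "x \<otimes> y = y \<otimes> x" "w \<in> carrier G"
  shows "x [^] (m::nat) \<otimes> (y [^] (n::nat) \<otimes> w) = y [^] n \<otimes> (x [^] m \<otimes> w)"
  using pow_commute_pow[OF assms(1-3), of m n] assms
  by (simp add: m_assoc[symmetric])

lemma (in monoid) pow_left_merge:
  assumes "x \<in> carrier G" "w \<in> carrier G"
  shows "x [^] (m::nat) \<otimes> (x [^] (n::nat) \<otimes> w) = x [^] (m + n) \<otimes> w"
  using assms by (simp add: m_assoc[symmetric] nat_pow_mult)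

section \<open>Straightening when the commutator is central\<close>

context assoc_algebra
begin

text \<open>A single \<open>y\<close> acts on powers of \<open>x\<close> as a derivation, since \<open>z\<close> commutes with \<open>x\<close>.\<close>

lemma straighten_one:
  assumes "x \<in> carrier A" "y \<in> carrier A" "z \<in> carrier A"
    and yx: "y \<otimes> x = x \<otimes> y \<oplus> c \<odot> z" and zx: "z \<otimes> x = x \<otimes> z"
  shows "y \<otimes> x [^] (r::nat) = x [^] r \<otimes> y \<oplus> (of_nat r * c) \<odot> (z \<otimes> x [^] (r - 1))"
proof (induction r)
  case 0
  then show ?case using assms by (simp add: smult_zero)
next
  case (Suc r)
  note [simp] = assms(1-3) smult_closed
  \<comment> \<open>For \<open>r = 0\<close> the exponent \<open>r - 1\<close> is truncated, but then the coefficient is zero.\<close>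
  have lower: "(of_nat r * c) \<odot> (z \<otimes> x [^] (r - Suc 0)) \<otimes> x = (of_nat r * c) \<odot> (z \<otimes> x [^] r)"
  proof (cases "r = 0")
    case False
    then have "x [^] r = x [^] (r - Suc 0) \<otimes> x"
      using nat_pow_Suc[of x "r - Suc 0"] by simp
    then show ?thesis
      by (simp add: smult_mult_left m_assoc)
  qed (simp add: smult_zero)
  have "y \<otimes> x [^] Suc r = (y \<otimes> x [^] r) \<otimes> x"
    by (simp add: m_assoc)
  also have "\<dots> = x [^] r \<otimes> (y \<otimes> x) \<oplus> (of_nat r * c) \<odot> (z \<otimes> x [^] r)"
    unfolding Suc by (simp add: l_distr lower m_assoc)
  also have "\<dots> = x [^] Suc r \<otimes> y \<oplus> (c \<odot> (z \<otimes> x [^] r) \<oplus> (of_nat r * c) \<odot> (z \<otimes> x [^] r))"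
    using commute_pow[OF assms(3,1) zx, of r]
    by (simp add: yx r_distr smult_mult_right m_assoc a_assoc)
  also have "c \<odot> (z \<otimes> x [^] r) \<oplus> (of_nat r * c) \<odot> (z \<otimes> x [^] r) =
      (of_nat (Suc r) * c) \<odot> (z \<otimes> x [^] r)"
    by (simp add: smult_l_distr[symmetric] algebra_simps)
  finally show ?case by simp
qed

end

text \<open>
  The number of ways to pair \<open>\<alpha>\<close> of \<open>n\<close> letters \<open>y\<close> with distinct letters among \<open>r\<close> letters \<open>x\<close>;
  each pair is contracted to its commutator when \<open>y\<^sup>n x\<^sup>r\<close> is brought into order.
\<close>

definition straighten_coeff :: "nat \<Rightarrow> nat \<Rightarrow> nat \<Rightarrow> nat"
  where "straighten_coeff n r \<alpha> = (n choose \<alpha>) * (r choose \<alpha>) * fact \<alpha>"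

lemma straighten_coeff_0 [simp]: "straighten_coeff n r 0 = 1"
  by (simp add: straighten_coeff_def)

lemma straighten_coeff_eq_0: "n < \<alpha> \<or> r < \<alpha> \<Longrightarrow> straighten_coeff n r \<alpha> = 0"
  by (auto simp: straighten_coeff_def)

text \<open>
  The leftmost of \<open>Suc n\<close> copies of \<open>y\<close> either is not among the \<open>Suc \<alpha>\<close> that differentiate, or it
  differentiates the power \<open>x\<^bsup>r-\<alpha>\<^esup>\<close> that the \<open>\<alpha>\<close> others leave behind.
\<close>

lemma straighten_coeff_Suc:
  "straighten_coeff (Suc n) r (Suc \<alpha>) =
    straighten_coeff n r (Suc \<alpha>) + straighten_coeff n r \<alpha> * (r - \<alpha>)"
proof -
  have absorb: "(r choose Suc \<alpha>) * Suc \<alpha> = (r choose \<alpha>) * (r - \<alpha>)"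
  proof (cases r)
    case (Suc r')
    then show ?thesis
      using binomial_absorption[of \<alpha> r] binomial_absorb_comp[of r \<alpha>] by (simp add: mult.commute)
  qed simp
  have "(n choose \<alpha>) * (r choose Suc \<alpha>) * fact (Suc \<alpha>) =
      (n choose \<alpha>) * ((r choose Suc \<alpha>) * Suc \<alpha>) * fact \<alpha>"
    by (simp only: fact_Suc of_nat_id mult_ac)
  also have "\<dots> = straighten_coeff n r \<alpha> * (r - \<alpha>)"
    unfolding absorb by (simp add: straighten_coeff_def)
  finally show ?thesis
    by (simp only: straighten_coeff_def binomial_Suc_Suc distrib_right add.commute)
qed

context assoc_algebra
begin

text \<open>
  Induction on \<open>n\<close>: a further \<open>y\<close> on the left either passes through the power of \<open>x\<close> or differentiates
  it, and collecting equal powers of \<open>z\<close> gives the recursion of \<open>straighten_coeff_Suc\<close>.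
\<close>

lemma straighten_powers:
  assumes [simp]: "x \<in> carrier A" "y \<in> carrier A" "z \<in> carrier A"
    and yx: "y \<otimes> x = x \<otimes> y \<oplus> c \<odot> z"
    and zx: "z \<otimes> x = x \<otimes> z" and zy: "z \<otimes> y = y \<otimes> z"
  shows "y [^] n \<otimes> x [^] r =
    (\<Oplus>\<alpha>\<in>{0..min n r}. (of_nat (straighten_coeff n r \<alpha>) * c ^ \<alpha>) \<odot>
      (z [^] \<alpha> \<otimes> (x [^] (r - \<alpha>) \<otimes> y [^] (n - \<alpha>))))"
proof -
  note [simp] = smult_closed
  let ?m = "\<lambda>n \<alpha>. z [^] \<alpha> \<otimes> (x [^] (r - \<alpha>) \<otimes> y [^] (n - \<alpha>))"
  let ?k = "\<lambda>n \<alpha>. of_nat (straighten_coeff n r \<alpha>) * c ^ \<alpha>"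
  have step: "y \<otimes> ?m n \<alpha> = ?m (Suc n) \<alpha> \<oplus> (of_nat (r - \<alpha>) * c) \<odot> ?m (Suc n) (Suc \<alpha>)"
    if "\<alpha> \<le> n" for n \<alpha> :: nat
  proof -
    have "y \<otimes> ?m n \<alpha> = z [^] \<alpha> \<otimes> ((y \<otimes> x [^] (r - \<alpha>)) \<otimes> y [^] (n - \<alpha>))"
      using pow_left_commute[of y z "x [^] (r - \<alpha>) \<otimes> y [^] (n - \<alpha>)" 1 \<alpha>] zy
      by (simp add: m_assoc)
    also have "\<dots> = z [^] \<alpha> \<otimes> (x [^] (r - \<alpha>) \<otimes> (y \<otimes> y [^] (n - \<alpha>))) \<oplus>
        (of_nat (r - \<alpha>) * c) \<odot> ((z [^] \<alpha> \<otimes> z) \<otimes> (x [^] (r - Suc \<alpha>) \<otimes> y [^] (n - \<alpha>)))"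
      unfolding straighten_one[OF assms(1-5), of "r - \<alpha>"]
      by (simp add: l_distr r_distr m_assoc smult_mult_left smult_mult_right del: nat_pow_Suc)
    also have "y \<otimes> y [^] (n - \<alpha>) = y [^] (Suc n - \<alpha>)"
      using that by (simp only: Suc_diff_le nat_pow_Suc2 assms)
    finally show ?thesis by simp
  qed
  have a_swap: "u \<oplus> v \<oplus> w = u \<oplus> w \<oplus> v"
    if "u \<in> carrier A" "v \<in> carrier A" "w \<in> carrier A" for u v w
    using that by (simp add: a_ac)
  \<comment> \<open>Summing up to \<open>n\<close> instead of \<open>min n r\<close> lets the induction step just shift the index;
    the coefficients beyond \<open>r\<close> vanish, so the truncated exponent \<open>r - \<alpha>\<close> is harmless there.\<close>
  have full: "y [^] n \<otimes> x [^] r = (\<Oplus>\<alpha>\<in>{..n}. ?k n \<alpha> \<odot> ?m n \<alpha>)"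
  proof (induction n)
    case 0
    then show ?case by (simp add: smult_one)
  next
    case (Suc n)
    let ?stay = "\<lambda>\<alpha>. ?k n \<alpha> \<odot> ?m (Suc n) \<alpha>"
    let ?hit = "\<lambda>\<alpha>. (of_nat (straighten_coeff n r \<alpha> * (r - \<alpha>)) * c ^ Suc \<alpha>) \<odot> ?m (Suc n) (Suc \<alpha>)"
    have "y [^] Suc n \<otimes> x [^] r = y \<otimes> (y [^] n \<otimes> x [^] r)"
      by (simp only: nat_pow_Suc2 m_assoc assms nat_pow_closed)
    also have "\<dots> = (\<Oplus>\<alpha>\<in>{..n}. y \<otimes> (?k n \<alpha> \<odot> ?m n \<alpha>))"
      unfolding Suc by (rule finsum_rdistr) auto
    also have "\<dots> = (\<Oplus>\<alpha>\<in>{..n}. ?stay \<alpha> \<oplus> ?hit \<alpha>)"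
      by (rule finsum_cong')
         (auto simp: smult_mult_right step smult_r_distr smult_assoc[symmetric] mult_ac
           simp del: nat_pow_Suc)
    also have "\<dots> = (\<Oplus>\<alpha>\<in>{..n}. ?stay \<alpha>) \<oplus> (\<Oplus>\<alpha>\<in>{..n}. ?hit \<alpha>)"
      by (rule finsum_addf) auto
    also have "(\<Oplus>\<alpha>\<in>{..n}. ?stay \<alpha>) = (\<Oplus>\<alpha>\<in>{..Suc n}. ?stay \<alpha>)"
      by (subst finsum_Suc) (auto simp: straighten_coeff_eq_0 smult_zero simp del: nat_pow_Suc)
    also have "\<dots> = (\<Oplus>\<alpha>\<in>{..n}. ?stay (Suc \<alpha>)) \<oplus> ?stay 0"
      by (subst finsum_Suc2) (auto simp del: nat_pow_Suc)
    also have "(\<Oplus>\<alpha>\<in>{..n}. ?stay (Suc \<alpha>)) \<oplus> ?stay 0 \<oplus> (\<Oplus>\<alpha>\<in>{..n}. ?hit \<alpha>) =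
        ((\<Oplus>\<alpha>\<in>{..n}. ?stay (Suc \<alpha>)) \<oplus> (\<Oplus>\<alpha>\<in>{..n}. ?hit \<alpha>)) \<oplus> ?stay 0"
      by (rule a_swap) auto
    also have "(\<Oplus>\<alpha>\<in>{..n}. ?stay (Suc \<alpha>)) \<oplus> (\<Oplus>\<alpha>\<in>{..n}. ?hit \<alpha>) =
        (\<Oplus>\<alpha>\<in>{..n}. ?stay (Suc \<alpha>) \<oplus> ?hit \<alpha>)"
      by (rule finsum_addf[symmetric]) auto
    also have "\<dots> = (\<Oplus>\<alpha>\<in>{..n}. ?k (Suc n) (Suc \<alpha>) \<odot> ?m (Suc n) (Suc \<alpha>))"
      by (rule finsum_cong')
         (auto simp: straighten_coeff_Suc smult_l_distr[symmetric] algebra_simps simp del: nat_pow_Suc)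
    also have "\<dots> \<oplus> ?stay 0 = (\<Oplus>\<alpha>\<in>{..Suc n}. ?k (Suc n) \<alpha> \<odot> ?m (Suc n) \<alpha>)"
      by (subst finsum_Suc2) (auto simp del: nat_pow_Suc)
    finally show ?case .
  qed
  show ?thesis
    unfolding full
    by (rule add.finprod_mono_neutral_cong_right)
       (auto simp: straighten_coeff_eq_0 smult_zero)
qed

section \<open>Products of ordered monomials\<close>

lemma smult_finsum:
  assumes "\<And>i. i \<in> I \<Longrightarrow> g i \<in> carrier A"
  shows "c \<odot> (\<Oplus>i\<in>I. g i) = (\<Oplus>i\<in>I. c \<odot> g i)"
  using assms
proof (induction I rule: infinite_finite_induct)
  case (insert i I)
  then show ?case
    by (simp add: Pi_def finsum_closed smult_r_distr smult_closed)
qed (use smult_assoc[of \<zero> c 0] smult_zero in simp_all)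

text \<open>
  The two straightenings are nested: the one of \<open>x5\<close> against \<open>x4\<^sup>s\<close> starts from the power
  \<open>x5\<^bsup>n-\<alpha>\<^esup>\<close> that the one against \<open>x3\<^sup>r\<close> leaves behind, which is why the inner range and the
  second coefficient depend on \<open>\<alpha>\<close>.
\<close>

lemma ordered_monomial_mult:
  assumes carr [simp]: "x1 \<in> carrier A" "x2 \<in> carrier A" "x3 \<in> carrier A" "x4 \<in> carrier A"
      "x5 \<in> carrier A"
    and c53: "x5 \<otimes> x3 = x3 \<otimes> x5 \<oplus> (- 1) \<odot> x1"
    and c54: "x5 \<otimes> x4 = x4 \<otimes> x5 \<oplus> (- 1) \<odot> x2"
    and c21: "x2 \<otimes> x1 = x1 \<otimes> x2" and c31: "x3 \<otimes> x1 = x1 \<otimes> x3"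
    and c41: "x4 \<otimes> x1 = x1 \<otimes> x4" and c51: "x5 \<otimes> x1 = x1 \<otimes> x5"
    and c32: "x3 \<otimes> x2 = x2 \<otimes> x3" and c42: "x4 \<otimes> x2 = x2 \<otimes> x4"
    and c52: "x5 \<otimes> x2 = x2 \<otimes> x5" and c43: "x4 \<otimes> x3 = x3 \<otimes> x4"
  defines "M \<equiv> \<lambda>a b c d e :: nat.
    x1 [^] a \<otimes> x2 [^] b \<otimes> x3 [^] c \<otimes> x4 [^] d \<otimes> x5 [^] e"
  shows "M j k l m n \<otimes> M p q r s t =
    (\<Oplus>\<alpha>\<in>{0..min n r}. \<Oplus>\<beta>\<in>{0..min (n - \<alpha>) s}.
      (of_nat (straighten_coeff n r \<alpha> * straighten_coeff (n - \<alpha>) s \<beta>) * (- 1) ^ (\<alpha> + \<beta>)) \<odot>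
        M (j + p + \<alpha>) (k + q + \<beta>) (l + r - \<alpha>) (m + s - \<beta>) (n + t - \<alpha> - \<beta>))"
proof -
  note [simp] = smult_closed
  note sort =
    pow_left_commute[OF carr(2) carr(1) c21] pow_left_commute[OF carr(3) carr(1) c31]
    pow_left_commute[OF carr(4) carr(1) c41] pow_left_commute[OF carr(5) carr(1) c51]
    pow_left_commute[OF carr(3) carr(2) c32] pow_left_commute[OF carr(4) carr(2) c42]
    pow_left_commute[OF carr(5) carr(2) c52] pow_left_commute[OF carr(4) carr(3) c43]
    pow_left_merge[OF carr(1)] pow_left_merge[OF carr(2)] pow_left_merge[OF carr(3)]
    pow_left_merge[OF carr(4)] nat_pow_mult
  let ?F = straighten_coeff
  let ?L = "x1 [^] (j + p) \<otimes> (x2 [^] (k + q) \<otimes> (x3 [^] l \<otimes> x4 [^] m))"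
  let ?R = "x4 [^] s \<otimes> x5 [^] t"
  let ?u = "\<lambda>\<alpha>. x1 [^] \<alpha> \<otimes> (x3 [^] (r - \<alpha>) \<otimes> x5 [^] (n - \<alpha>))"
  let ?v = "\<lambda>\<alpha> \<beta>. x2 [^] \<beta> \<otimes> (x4 [^] (s - \<beta>) \<otimes> x5 [^] (n - \<alpha> - \<beta>))"
  let ?a = "\<lambda>\<alpha>. of_nat (?F n r \<alpha>) * (- 1) ^ \<alpha> :: 'k"
  let ?b = "\<lambda>\<alpha> \<beta>. of_nat (?F (n - \<alpha>) s \<beta>) * (- 1) ^ \<beta> :: 'k"
  have block3: "x5 [^] n \<otimes> x3 [^] r = (\<Oplus>\<alpha>\<in>{0..min n r}. ?a \<alpha> \<odot> ?u \<alpha>)"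
    by (rule straighten_powers) (use c53 c31 c51 in simp_all)
  have block4: "x5 [^] (n - \<alpha>) \<otimes> x4 [^] s = (\<Oplus>\<beta>\<in>{0..min (n - \<alpha>) s}. ?b \<alpha> \<beta> \<odot> ?v \<alpha> \<beta>)" for \<alpha>
    by (rule straighten_powers) (use c54 c42 c52 in simp_all)
  have inner: "?L \<otimes> (?u \<alpha> \<otimes> ?R) =
      (\<Oplus>\<beta>\<in>{0..min (n - \<alpha>) s}. ?b \<alpha> \<beta> \<odot>
        M (j + p + \<alpha>) (k + q + \<beta>) (l + r - \<alpha>) (m + s - \<beta>) (n + t - \<alpha> - \<beta>))"
    if "\<alpha> \<in> {0..min n r}" for \<alpha>
  proof -
    let ?P = "?L \<otimes> (x1 [^] \<alpha> \<otimes> x3 [^] (r - \<alpha>))"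
    have merge: "?P \<otimes> ?v \<alpha> \<beta> \<otimes> x5 [^] t =
        M (j + p + \<alpha>) (k + q + \<beta>) (l + r - \<alpha>) (m + s - \<beta>) (n + t - \<alpha> - \<beta>)"
      if "\<beta> \<in> {0..min (n - \<alpha>) s}" for \<beta>
    proof -
      \<comment> \<open>The subtractions are genuine for these \<open>\<alpha>\<close> and \<open>\<beta>\<close>, so merging exponents adds up correctly.\<close>
      have "l + (r - \<alpha>) = l + r - \<alpha>" "m + (s - \<beta>) = m + s - \<beta>"
        "n - \<alpha> - \<beta> + t = n + t - \<alpha> - \<beta>"
        using that \<open>\<alpha> \<in> {0..min n r}\<close> by auto
      then show ?thesis
        by (simp add: M_def m_assoc sort)
    qed
    have "?L \<otimes> (?u \<alpha> \<otimes> ?R) = ?P \<otimes> (x5 [^] (n - \<alpha>) \<otimes> x4 [^] s) \<otimes> x5 [^] t"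
      by (simp add: m_assoc)
    also have "\<dots> = (\<Oplus>\<beta>\<in>{0..min (n - \<alpha>) s}. ?P \<otimes> (?b \<alpha> \<beta> \<odot> ?v \<alpha> \<beta>) \<otimes> x5 [^] t)"
      unfolding block4 by (simp add: finsum_rdistr finsum_ldistr Pi_def)
    also have "\<dots> = (\<Oplus>\<beta>\<in>{0..min (n - \<alpha>) s}. ?b \<alpha> \<beta> \<odot> (?P \<otimes> ?v \<alpha> \<beta> \<otimes> x5 [^] t))"
      by (rule finsum_cong') (auto simp: smult_mult_left smult_mult_right)
    also have "\<dots> = (\<Oplus>\<beta>\<in>{0..min (n - \<alpha>) s}. ?b \<alpha> \<beta> \<odot>
        M (j + p + \<alpha>) (k + q + \<beta>) (l + r - \<alpha>) (m + s - \<beta>) (n + t - \<alpha> - \<beta>))"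
      by (rule finsum_cong') (auto simp only: merge Pi_iff M_def intro!: smult_closed m_closed nat_pow_closed carr)
    finally show ?thesis .
  qed
  have "M j k l m n \<otimes> M p q r s t = ?L \<otimes> ((x5 [^] n \<otimes> x3 [^] r) \<otimes> ?R)"
    by (simp add: M_def m_assoc sort)
  also have "\<dots> = (\<Oplus>\<alpha>\<in>{0..min n r}. ?L \<otimes> ((?a \<alpha> \<odot> ?u \<alpha>) \<otimes> ?R))"
    unfolding block3 by (simp add: finsum_rdistr finsum_ldistr Pi_def)
  also have "\<dots> = (\<Oplus>\<alpha>\<in>{0..min n r}. ?a \<alpha> \<odot> (?L \<otimes> (?u \<alpha> \<otimes> ?R)))"
    by (rule finsum_cong') (auto simp: smult_mult_left smult_mult_right)
  also have "\<dots> = (\<Oplus>\<alpha>\<in>{0..min n r}. \<Oplus>\<beta>\<in>{0..min (n - \<alpha>) s}.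
      (of_nat (?F n r \<alpha> * ?F (n - \<alpha>) s \<beta>) * (- 1) ^ (\<alpha> + \<beta>)) \<odot>
        M (j + p + \<alpha>) (k + q + \<beta>) (l + r - \<alpha>) (m + s - \<beta>) (n + t - \<alpha> - \<beta>))"
    by (intro finsum_cong' refl)
       (auto simp: inner smult_finsum M_def smult_assoc[symmetric] power_add mult_ac
         intro!: finsum_closed finsum_cong')
  finally show ?thesis .
qed

end

section \<open>The enveloping algebra\<close>

lemma uea_embed_commutator:
  "uea_embed scale bracket x \<otimes>\<^bsub>uea scale bracket\<^esub> uea_embed scale bracket y =
    uea_embed scale bracket y \<otimes>\<^bsub>uea scale bracket\<^esub> uea_embed scale bracket x
      \<oplus>\<^bsub>uea scale bracket\<^esub> uea_embed scale bracket (bracket x y)"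
proof -
  interpret U: ring "uea scale bracket"
    by (rule ring_uea)
  show ?thesis
    unfolding uea_embed_bracket
    by (simp add: uea_embed_closed U.minus_eq U.a_lcomm U.r_neg)
qed

theorem theorem4p4:
  fixes scale :: "'k::real_or_complex \<Rightarrow> 'a::ab_group_add \<Rightarrow> 'a"
    and bracket :: "'a \<Rightarrow> 'a \<Rightarrow> 'a"
    and x1 x2 x3 x4 x5 :: 'a
    and j k l m n p q r s t :: nat
  assumes "n5_1 scale bracket x1 x2 x3 x4 x5"
  shows "let U = uea scale bracket;
             \<iota> = uea_embed scale bracket;
             mon = (\<lambda>a b c d e :: nat.
               \<iota> x1 [^]\<^bsub>U\<^esub> a \<otimes>\<^bsub>U\<^esub> \<iota> x2 [^]\<^bsub>U\<^esub> b \<otimes>\<^bsub>U\<^esub> \<iota> x3 [^]\<^bsub>U\<^esub> c \<otimes>\<^bsub>U\<^esub> \<iota> x4 [^]\<^bsub>U\<^esub> d \<otimes>\<^bsub>U\<^esub> \<iota> x5 [^]\<^bsub>U\<^esub> e)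
         in mon j k l m n \<otimes>\<^bsub>U\<^esub> mon p q r s t =
            (\<Oplus>\<^bsub>U\<^esub>\<alpha>\<in>{0..min n r}. \<Oplus>\<^bsub>U\<^esub>\<beta>\<in>{0..min (n - \<alpha>) s}.
              (of_nat ((n choose \<alpha>) * (r choose \<alpha>) * ((n - \<alpha>) choose \<beta>) * (s choose \<beta>)
                 * fact \<alpha> * fact \<beta>) * (- 1) ^ (\<alpha> + \<beta>))
              \<odot>\<^bsub>U\<^esub> mon (j + p + \<alpha>) (k + q + \<beta>) (l + r - \<alpha>) (m + s - \<beta>) (n + t - \<alpha> - \<beta>))"
proof -
  interpret n5_1 scale bracket x1 x2 x3 x4 x5
    by (rule assms)
  let ?U = "uea scale bracket" and ?i = "uea_embed scale bracket"
  interpret U: assoc_algebra ?U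
    by (rule assoc_algebra_uea)
  note [simp] = uea_embed_closed U.smult_closed
  have embed_0: "?i 0 = \<zero>\<^bsub>?U\<^esub>"
    using uea_embed_scale[of scale bracket 0 0] by (simp add: U.smult_zero)
  have embed_minus: "?i (- x) = (- 1) \<odot>\<^bsub>?U\<^esub> ?i x" for x
    using uea_embed_scale[of scale bracket "- 1" x] by simp
  have commute: "?i x \<otimes>\<^bsub>?U\<^esub> ?i y = ?i y \<otimes>\<^bsub>?U\<^esub> ?i x" if "bracket x y = 0" for x y
    using uea_embed_commutator[of scale bracket x y] that by (simp add: embed_0)
  have c53: "?i x5 \<otimes>\<^bsub>?U\<^esub> ?i x3 = ?i x3 \<otimes>\<^bsub>?U\<^esub> ?i x5 \<oplus>\<^bsub>?U\<^esub> (- 1) \<odot>\<^bsub>?U\<^esub> ?i x1"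
    using uea_embed_commutator[of scale bracket x5 x3] by (simp add: bracket_53 embed_minus)
  have c54: "?i x5 \<otimes>\<^bsub>?U\<^esub> ?i x4 = ?i x4 \<otimes>\<^bsub>?U\<^esub> ?i x5 \<oplus>\<^bsub>?U\<^esub> (- 1) \<odot>\<^bsub>?U\<^esub> ?i x2"
    using uea_embed_commutator[of scale bracket x5 x4] by (simp add: bracket_54 embed_minus)
  have coeff: "(n choose \<alpha>) * (r choose \<alpha>) * ((n - \<alpha>) choose \<beta>) * (s choose \<beta>) * fact \<alpha> * fact \<beta> =
      straighten_coeff n r \<alpha> * straighten_coeff (n - \<alpha>) s \<beta>" for \<alpha> \<beta>
    by (simp add: straighten_coeff_def)
  show ?thesis
    unfolding Let_def coeff
    by (rule U.ordered_monomial_mult)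
       (simp_all add: c53 c54 commute bracket_21 bracket_31 bracket_41 bracket_51 bracket_32
         bracket_42 bracket_52 bracket_43)
qed

end
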